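(* Let $n\ge1$, $1\le k\le n$, and let $\mu$ be a partition with $\mu_1\le n$. The eigenvalue of the action of the central element $\mathbf{H}_k(n)$ on the irreducible $gl(n)$-module $Schur_\mu(n)$ equals $$\sum_{1\le i_1<i_2<\cdots<i_k\le n}\ \sum_\sigma\ \Gamma_\sigma(\mu;i_1,i_2,\dots,i_k),$$ where the inner sum ranges over all permutations $\sigma$ of the set $\{i_1,i_2,\dots,i_k\}$.
   Context: $gl(n)=gl(n,\mathbb C)$ with standard basis $e_{i,j}$. For a matrix with noncommuting entries, $\mathbf{cdet}(A)=\sum_\sigma(-1)^{|\sigma|}a_{\sigma(1),1}\cdots a_{\sigma(k),k}$, and $$\mathbf{H}_k(n)=\sum_{1\le i_1<\cdots<i_k\le n}\mathbf{cdet}\big[e_{i_a,i_b}+\delta_{ab}(k-a)\big]_{a,b=1,\dots,k}\in\mathbf{U}(gl(n)),$$ which is central. For a partition $\mu$ with $\mu_1\le n$, $Schur_\mu(n)$ is the irreducible $gl(n)$-module of highest weight $\widetilde\mu$ (the conjugate partition, padded by zeros to length $n$). For a permutation $\sigma$ of $\{i_1,\dots,i_k\}\subseteq\{1,\dots,n\}$, $$\Gamma_\sigma(\mu;i_1,\dots,i_k)=(\widetilde\mu_{i_1})^{h_\sigma(i_1)}(\widetilde\mu_{i_2})^{h_\sigma(i_2)}\cdots(\widetilde\mu_{i_k})^{h_\sigma(i_k)},$$ where $h_\sigma(j)=1$ if $j$ is the maximum element of a cycle in the cycle decomposition of $\sigma$ (fixed points being cycles of length one), and $h_\sigma(j)=0$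 otherwise; a factor with exponent $0$ is equal to $1$. *)

theory Defs
  imports
    "HOL-Analysis.Analysis"
    "HOL-Library.Poly_Mapping"
    "HOL-Combinatorics.Orbits"
begin

section \<open>The Lie algebra \<open>gl(n)\<close> and its modules\<close>

text \<open>
  \<open>gl(n)\<close> is the type \<open>complex^'n^'n\<close>, where \<open>'n\<close> is a finite linearly ordered type with
  \<open>n = CARD('n)\<close> elements; its order plays the role of the order of \<open>{1, \<dots>, n}\<close>, and
  \<open>pos\<close> is the order isomorphism from \<open>'n\<close> onto \<open>{1, \<dots>, n}\<close>.
\<close>

type_synonym 'n gl = "complex^'n^'n"

definition pos :: "'n::{finite,linorder} \<Rightarrow> nat"
  where "pos i = card {..i}"

definition gl_scale :: "complex \<Rightarrow> 'n gl \<Rightarrow> 'n::finite gl"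
  where "gl_scale c A = (\<chi> i j. c * A $ i $ j)"

definition gl_bracket :: "'n gl \<Rightarrow> 'n gl \<Rightarrow> 'n::finite gl"
  where "gl_bracket A B = A ** B - B ** A"

definition elem_mat :: "'n \<Rightarrow> 'n \<Rightarrow> 'n::finite gl"
  where "elem_mat i j = (\<chi> a b. if a = i \<and> b = j then 1 else 0)"

locale gl_module = vector_space sc
  for sc :: "complex \<Rightarrow> 'v::ab_group_add \<Rightarrow> 'v" +
  fixes \<rho> :: "'n::finite gl \<Rightarrow> 'v \<Rightarrow> 'v"
  assumes act_linear: "Vector_Spaces.linear sc sc (\<rho> A)"
    and act_add: "\<rho> (A + B) v = \<rho> A v + \<rho> B v"
    and act_scale: "\<rho> (gl_scale c A) v = sc c (\<rho> A v)"
    and act_bracket: "\<rho> (gl_bracket A B) v = \<rho> A (\<rho> B v) - \<rho> B (\<rho> A v)"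

definition irreducible_gl_module ::
  "(complex \<Rightarrow> 'v::ab_group_add \<Rightarrow> 'v) \<Rightarrow> ('n::finite gl \<Rightarrow> 'v \<Rightarrow> 'v) \<Rightarrow> bool"
  where "irreducible_gl_module sc \<rho> \<longleftrightarrow>
    gl_module sc \<rho> \<and> (\<exists>v::'v. v \<noteq> 0) \<and>
    (\<forall>W. module.subspace sc W \<and> (\<forall>A. \<forall>w\<in>W. \<rho> A w \<in> W) \<longrightarrow> W = {0} \<or> W = UNIV)"

definition highest_weight_vector ::
  "(complex \<Rightarrow> 'v::ab_group_add \<Rightarrow> 'v) \<Rightarrow> ('n::{finite,linorder} gl \<Rightarrow> 'v \<Rightarrow> 'v)
    \<Rightarrow> ('n \<Rightarrow> complex) \<Rightarrow> 'v \<Rightarrow> bool"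
  where "highest_weight_vector sc \<rho> wt v \<longleftrightarrow>
    v \<noteq> 0 \<and>
    (\<forall>i. \<rho> (elem_mat i i) v = sc (wt i) v) \<and>
    (\<forall>i j. i < j \<longrightarrow> \<rho> (elem_mat i j) v = 0)"


section \<open>Partitions and Schur modules\<close>

definition is_partition :: "nat list \<Rightarrow> bool"
  where "is_partition \<mu> \<longleftrightarrow> sorted_wrt (\<ge>) \<mu> \<and> 0 \<notin> set \<mu>"

definition partition_part :: "nat list \<Rightarrow> nat \<Rightarrow> nat"
  where "partition_part \<mu> i = (if 1 \<le> i \<and> i \<le> length \<mu> then \<mu> ! (i - 1) else 0)"

definition conj_part :: "nat list \<Rightarrow> nat \<Rightarrow> nat"
  where "conj_part \<mu> j = card {i \<in> {1..length \<mu>}. j \<le> partition_part \<mu> i}"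

definition schur_weight :: "nat list \<Rightarrow> 'n::{finite,linorder} \<Rightarrow> complex"
  where "schur_weight \<mu> i = of_nat (conj_part \<mu> (pos i))"

text \<open>The Schur module is determined up to isomorphism by its highest weight, hence a predicate.\<close>

definition is_Schur_module ::
  "(complex \<Rightarrow> 'v::ab_group_add \<Rightarrow> 'v) \<Rightarrow> ('n::{finite,linorder} gl \<Rightarrow> 'v \<Rightarrow> 'v)
    \<Rightarrow> nat list \<Rightarrow> bool"
  where "is_Schur_module sc \<rho> \<mu> \<longleftrightarrow>
    irreducible_gl_module sc \<rho> \<and> (\<exists>v. highest_weight_vector sc \<rho> (schur_weight \<mu>) v)"


section \<open>Free associative algebras\<close>

text \<open>
  Words form a monoid, written additively because \<open>Poly_Mapping\<close> equips finitely supported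
  functions on an additive monoid with the convolution product. The ring
  \<open>'a word \<Rightarrow>\<^sub>0 complex\<close> is the free associative complex algebra on the set \<open>'a\<close>;
  \<open>Poly_Mapping.single 0 c\<close> is the scalar \<open>c\<close>.
\<close>

datatype 'a word = Word (letters: "'a list")

instantiation word :: (type) monoid_add
begin
definition zero_word :: "'a word" where "0 = Word []"
definition plus_word :: "'a word \<Rightarrow> 'a word \<Rightarrow> 'a word"
  where "u + w = Word (letters u @ letters w)"
instance by standard (simp_all add: zero_word_def plus_word_def)
end

type_synonym 'a free_algebra = "'a word \<Rightarrow>\<^sub>0 complex"

definition letter :: "'a \<Rightarrow> 'a free_algebra"
  where "letter a = Poly_Mapping.single (Word [a]) 1"

definition free_act ::
  "(complex \<Rightarrow> 'v::ab_group_add \<Rightarrow> 'v) \<Rightarrow> ('a \<Rightarrow> 'v \<Rightarrow> 'v) \<Rightarrow> 'a free_algebra \<Rightarrow> 'v \<Rightarrow> 'v"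
  where "free_act sc \<rho> f v =
    (\<Sum>w\<in>Poly_Mapping.keys f. sc (Poly_Mapping.lookup f w) (foldr \<rho> (letters w) v))"


section \<open>The universal enveloping algebra \<open>U(gl(n))\<close>\<close>

text \<open>
  The first two families of relators turn the free algebra on the underlying set of \<open>gl(n)\<close>
  into the tensor algebra of \<open>gl(n)\<close>.
\<close>

inductive_set env_ideal :: "'n::finite gl free_algebra set" where
  zero: "0 \<in> env_ideal"
| rel_add: "letter (A + B) - (letter A + letter B) \<in> env_ideal"
| rel_scale: "letter (gl_scale c A) - Poly_Mapping.single 0 c * letter A \<in> env_ideal"
| rel_bracket: "letter A * letter B - letter B * letter A - letter (gl_bracket A B) \<in> env_ideal"
| add: "f \<in> env_ideal \<Longrightarrow> g \<in> env_ideal \<Longrightarrow> f + g \<in> env_ideal"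
| mult_left: "f \<in> env_ideal \<Longrightarrow> h * f \<in> env_ideal"
| mult_right: "f \<in> env_ideal \<Longrightarrow> f * h \<in> env_ideal"

lemma env_ideal_minus: "f \<in> env_ideal \<Longrightarrow> - f \<in> env_ideal"
  using env_ideal.mult_left[of f "-1"] by simp

lemma env_ideal_diff: "f \<in> env_ideal \<Longrightarrow> g \<in> env_ideal \<Longrightarrow> f - g \<in> env_ideal"
  using env_ideal.add[of f "-g"] env_ideal_minus by auto

context gl_module
begin

lemma free_act_superset:
  assumes "finite K" "Poly_Mapping.keys f \<subseteq> K"
  shows "free_act sc \<rho> f v = (\<Sum>w\<in>K. sc (Poly_Mapping.lookup f w) (foldr \<rho> (letters w) v))"
  unfolding free_act_def
  by (rule sum.mono_neutral_left) (use assms in \<open>auto simp: Poly_Mapping.in_keys_iff\<close>)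

lemma free_act_0 [simp]: "free_act sc \<rho> 0 v = 0"
  by (simp add: free_act_def)

lemma free_act_single:
  "free_act sc \<rho> (Poly_Mapping.single w c) v = sc c (foldr \<rho> (letters w) v)"
  by (simp add: free_act_def)

lemma free_act_1: "free_act sc \<rho> 1 v = v"
  by (simp add: free_act_def) (simp add: zero_word_def)

lemma free_act_add: "free_act sc \<rho> (f + g) v = free_act sc \<rho> f v + free_act sc \<rho> g v"
proof -
  let ?K = "Poly_Mapping.keys f \<union> Poly_Mapping.keys g"
  have "Poly_Mapping.keys (f + g) \<subseteq> ?K" by (rule Poly_Mapping.keys_add)
  then show ?thesis
    by (simp add: free_act_superset[of ?K] Poly_Mapping.lookup_add scale_left_distrib sum.distrib)
qed

lemma free_act_uminus: "free_act sc \<rho> (- f) v = - free_act sc \<rho> f v"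
  using free_act_add[of f "- f" v] by (simp add: eq_neg_iff_add_eq_0 add.commute)

lemma free_act_diff: "free_act sc \<rho> (f - g) v = free_act sc \<rho> f v - free_act sc \<rho> g v"
  using free_act_add[of f "- g" v] by (simp add: free_act_uminus)

lemma act_zero_right [simp]: "\<rho> A 0 = 0"
  using module_hom.zero[OF Vector_Spaces.linear.axioms(3)[OF act_linear]] .

lemma act_add_right: "\<rho> A (v + w) = \<rho> A v + \<rho> A w"
  using module_hom.add[OF Vector_Spaces.linear.axioms(3)[OF act_linear]] .

lemma act_scale_right: "\<rho> A (sc c v) = sc c (\<rho> A v)"
  using module_hom.scale[OF Vector_Spaces.linear.axioms(3)[OF act_linear]] .

lemma foldr_act_add: "foldr \<rho> xs (v + w) = foldr \<rho> xs v + foldr \<rho> xs w"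
  by (induction xs) (simp_all add: act_add_right)

lemma foldr_act_scale: "foldr \<rho> xs (sc c v) = sc c (foldr \<rho> xs v)"
  by (induction xs) (simp_all add: act_scale_right)

lemma free_act_add_right: "free_act sc \<rho> f (v + w) = free_act sc \<rho> f v + free_act sc \<rho> f w"
  by (simp add: free_act_def foldr_act_add scale_right_distrib sum.distrib)

lemma free_act_scale_right: "free_act sc \<rho> f (sc c v) = sc c (free_act sc \<rho> f v)"
  by (simp add: free_act_def foldr_act_scale scale_sum_right mult.commute)

lemma free_act_zero_right [simp]: "free_act sc \<rho> f 0 = 0"
  using free_act_scale_right[of f 0 0] by simp

lemma update_eq_add_single:
  "a \<notin> Poly_Mapping.keys f \<Longrightarrow> Poly_Mapping.update a b f = Poly_Mapping.single a b + f"
  by (rule Poly_Mapping.poly_mapping_eqI) (auto simp: Poly_Mapping.lookup_update Poly_Mapping.lookup_add Poly_Mapping.lookup_single Poly_Mapping.in_keys_iff when_def)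

lemma free_act_mult: "free_act sc \<rho> (f * g) v = free_act sc \<rho> f (free_act sc \<rho> g v)"
proof (induction f rule: Poly_Mapping.update_induct)
  case const
  then show ?case by simp
next
  case (update f a b)
  have *: "free_act sc \<rho> (Poly_Mapping.single a b * g) v =
      free_act sc \<rho> (Poly_Mapping.single a b) (free_act sc \<rho> g v)"
  proof (induction g rule: Poly_Mapping.update_induct)
    case const
    then show ?case by simp
  next
    case (update g a' b')
    then show ?case
      by (simp add: update_eq_add_single distrib_left free_act_add free_act_add_right
          Poly_Mapping.mult_single free_act_single plus_word_def foldr_act_scale)
  qed
  show ?case
    using update by (simp add: update_eq_add_single distrib_right free_act_add *)
qed

lemma free_act_letter: "free_act sc \<rho> (letter A) v = \<rho> A v"
  by (simp add: letter_def free_act_single)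

lemma free_act_env_ideal: "f \<in> env_ideal \<Longrightarrow> free_act sc \<rho> f v = 0"
  by (induction f arbitrary: v rule: env_ideal.induct)
    (simp_all add: free_act_diff free_act_add free_act_mult free_act_letter free_act_single
      act_add act_scale act_bracket zero_word_def)

end

lemma gl_module_trivial: "gl_module (*) (\<lambda>(A::'n::finite gl) (v::complex). 0)"
  by unfold_locales (simp_all add: algebra_simps)

lemma one_notin_env_ideal: "1 \<notin> (env_ideal :: 'n::finite gl free_algebra set)"
proof
  assume "1 \<in> (env_ideal :: 'n gl free_algebra set)"
  then have "free_act (*) (\<lambda>(A::'n gl) (v::complex). 0) 1 1 = 0"
    by (rule gl_module.free_act_env_ideal[OF gl_module_trivial])
  then show False
    by (simp add: gl_module.free_act_1[OF gl_module_trivial])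
qed

definition env_rel :: "'n::finite gl free_algebra \<Rightarrow> 'n gl free_algebra \<Rightarrow> bool"
  where "env_rel f g \<longleftrightarrow> f - g \<in> env_ideal"

quotient_type 'n ugl = "'n::finite gl free_algebra" / env_rel
proof (rule equivpI)
  show "reflp (env_rel :: 'n gl free_algebra \<Rightarrow> _)"
    by (auto intro!: reflpI simp: env_rel_def env_ideal.zero)
  show "symp (env_rel :: 'n gl free_algebra \<Rightarrow> _)"
    using env_ideal_minus by (fastforce intro!: sympI simp: env_rel_def)
  show "transp (env_rel :: 'n gl free_algebra \<Rightarrow> _)"
    using env_ideal.add by (fastforce intro!: transpI simp: env_rel_def)
qed

instantiation ugl :: (finite) ring_1
begin

lift_definition zero_ugl :: "'a ugl" is 0 .
lift_definition one_ugl :: "'a ugl" is 1 .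

lift_definition plus_ugl :: "'a ugl \<Rightarrow> 'a ugl \<Rightarrow> 'a ugl" is "(+)"
  using env_ideal.add by (fastforce simp: env_rel_def algebra_simps)

lift_definition uminus_ugl :: "'a ugl \<Rightarrow> 'a ugl" is uminus
  using env_ideal_minus by (fastforce simp: env_rel_def)

lift_definition minus_ugl :: "'a ugl \<Rightarrow> 'a ugl \<Rightarrow> 'a ugl" is "(-)"
  using env_ideal_diff by (fastforce simp: env_rel_def algebra_simps)

lift_definition times_ugl :: "'a ugl \<Rightarrow> 'a ugl \<Rightarrow> 'a ugl" is "(*)"
proof -
  fix f f' g g' :: "'a gl free_algebra"
  assume "env_rel f f'" "env_rel g g'"
  then have "(f - f') * g + f' * (g - g') \<in> env_ideal"
    by (auto simp: env_rel_def intro: env_ideal.intros)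
  then show "env_rel (f * g) (f' * g')"
    by (simp add: env_rel_def algebra_simps)
qed

instance
proof
  show "(0::'a ugl) \<noteq> 1"
    by transfer (use env_ideal_minus one_notin_env_ideal in \<open>fastforce simp: env_rel_def\<close>)
qed (transfer; simp add: env_rel_def env_ideal.zero algebra_simps)+

end

lift_definition ugl_of :: "'n::finite gl \<Rightarrow> 'n ugl" is letter .

definition e_gen :: "'n \<Rightarrow> 'n \<Rightarrow> 'n::finite ugl"
  where "e_gen i j = ugl_of (elem_mat i j)"

text \<open>
  The action of \<open>U(gl(n))\<close> on a \<open>gl(n)\<close>-module is computed on an arbitrary representative in
  the free algebra; \<open>ugl_act_abs\<close> below shows that the choice is irrelevant, and the lemmas
  after it that this is the unital algebra action extending \<open>\<rho>\<close>.
\<close>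

definition ugl_act ::
  "(complex \<Rightarrow> 'v::ab_group_add \<Rightarrow> 'v) \<Rightarrow> ('n::finite gl \<Rightarrow> 'v \<Rightarrow> 'v) \<Rightarrow> 'n ugl \<Rightarrow> 'v \<Rightarrow> 'v"
  where "ugl_act sc \<rho> u = free_act sc \<rho> (rep_ugl u)"

context gl_module
begin

lemma ugl_act_abs: "ugl_act sc \<rho> (abs_ugl f) v = free_act sc \<rho> f v"
proof -
  have "env_rel (rep_ugl (abs_ugl f)) f"
    by (rule Quotient3_rep_abs[OF Quotient3_ugl]) (simp add: env_rel_def env_ideal.zero)
  then have "free_act sc \<rho> (rep_ugl (abs_ugl f) - f) v = 0"
    by (simp add: env_rel_def free_act_env_ideal)
  then show ?thesis
    by (simp add: ugl_act_def free_act_diff)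
qed

lemma ugl_act_ugl_of: "ugl_act sc \<rho> (ugl_of A) v = \<rho> A v"
  by (simp add: ugl_of.abs_eq ugl_act_abs free_act_letter)

lemma ugl_act_0: "ugl_act sc \<rho> 0 v = 0"
  by (simp add: zero_ugl.abs_eq ugl_act_abs)

lemma ugl_act_1: "ugl_act sc \<rho> 1 v = v"
  by (simp add: one_ugl.abs_eq ugl_act_abs free_act_1)

lemma ugl_act_add: "ugl_act sc \<rho> (x + y) v = ugl_act sc \<rho> x v + ugl_act sc \<rho> y v"
proof -
  obtain f g where "x = abs_ugl f" "y = abs_ugl g"
    using Quotient3_abs_rep[OF Quotient3_ugl] by metis
  then show ?thesis by (simp add: plus_ugl.abs_eq ugl_act_abs free_act_add)
qed

lemma ugl_act_mult: "ugl_act sc \<rho> (x * y) v = ugl_act sc \<rho> x (ugl_act sc \<rho> y v)"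
proof -
  obtain f g where "x = abs_ugl f" "y = abs_ugl g"
    using Quotient3_abs_rep[OF Quotient3_ugl] by metis
  then show ?thesis by (simp add: times_ugl.abs_eq ugl_act_abs free_act_mult)
qed

end


section \<open>Column determinants and the elements \<open>H\<^sub>k(n)\<close>\<close>

definition cdet :: "nat \<Rightarrow> (nat \<Rightarrow> nat \<Rightarrow> 'a::ring_1) \<Rightarrow> 'a"
  where "cdet k A =
    (\<Sum>\<sigma> | \<sigma> permutes {1..k}. of_int (sign \<sigma>) * prod_list (map (\<lambda>j. A (\<sigma> j) j) [1..<Suc k]))"

text \<open>The sequences \<open>i\<^sub>1 < \<dots> < i\<^sub>k\<close>, as extensional functions so that there are finitely many.\<close>

definition increasing_seqs :: "nat \<Rightarrow> (nat \<Rightarrow> 'n::{finite,linorder}) set"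
  where "increasing_seqs k = {i \<in> {1..k} \<rightarrow>\<^sub>E UNIV. strict_mono_on {1..k} i}"

definition H_elem :: "nat \<Rightarrow> 'n::{finite,linorder} ugl"
  where "H_elem k = (\<Sum>i\<in>increasing_seqs k.
    cdet k (\<lambda>a b. e_gen (i a) (i b) + (if a = b then of_nat (k - a) else 0)))"


section \<open>The monomials \<open>\<Gamma>\<^sub>\<sigma>\<close>\<close>

text \<open>For a permutation \<open>\<sigma>\<close> of a finite set, \<open>orbit \<sigma> j\<close> is the cycle of \<open>\<sigma>\<close> containing \<open>j\<close>.\<close>

definition cycle_max :: "('n::linorder \<Rightarrow> 'n) \<Rightarrow> 'n \<Rightarrow> nat"
  where "cycle_max \<sigma> j = (if j = Max (orbit \<sigma> j) then 1 else 0)"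

definition Gam :: "('n \<Rightarrow> 'n) \<Rightarrow> nat list \<Rightarrow> nat \<Rightarrow> (nat \<Rightarrow> 'n::{finite,linorder}) \<Rightarrow> complex"
  where "Gam \<sigma> \<mu> k i = (\<Prod>a = 1..k. schur_weight \<mu> (i a) ^ cycle_max \<sigma> (i a))"

end

theory Submission
  imports Defs
begin

text \<open>
  Let \<open>D(a; b)\<close> be the shifted column determinant with row indices \<open>a\<close> and column indices \<open>b\<close>,
  repetitions allowed. It is alternating in \<open>a\<close>, and, thanks to the shifts, also in \<open>b\<close>, so the
  sum of \<open>D(a; a)\<close> over all \<open>k\<close>-tuples \<open>a\<close> is \<open>k! H\<^sub>k(n)\<close>. Bracketing this sum with a generator
  gives two families of terms that cancel, so \<open>H\<^sub>k(n)\<close> commutes with \<open>gl(n)\<close>, and its eigenspaces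
  in an irreducible module are \<open>0\<close> or everything. On a highest weight vector only the
  identity permutation contributes to the column determinant, with eigenvalue
  \<open>\<Prod>\<^sub>a (wt(i\<^sub>a) + k - a)\<close>. This product is the sum of the monomials \<open>\<Gamma>\<^sub>\<sigma>\<close>, because a
  permutation is built by inserting the elements of the set in decreasing order.
\<close>

section \<open>Summing monomials over permutations\<close>

lemma finite_orbit_permutes:
  assumes "finite S" "f permutes S" "s \<in> S"
  shows "finite (orbit f s)" "s \<in> orbit f s" "orbit f s \<subseteq> S"
proof -
  show sub: "orbit f s \<subseteq> S"
  proof
    fix y assume "y \<in> orbit f s"
    then show "y \<in> S"
      by induction (use assms permutes_in_image[of f S] in auto)
  qed
  then show "finite (orbit f s)"
    using assms(1) finite_subset by blast
  show "s \<in> orbit f s"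
    by (rule permutation_self_in_orbit) (use assms in \<open>auto simp: permutation_permutes\<close>)
qed

text \<open>The composition splices \<open>m\<close> into the cycle of \<open>q\<close> through
  \<open>b\<close>, directly before \<open>b\<close>: the \<open>q\<close>-preimage of
  \<open>b\<close> now goes to \<open>m\<close>, and \<open>m\<close> to \<open>b\<close>. No other
  arrow changes.\<close>

lemma orbit_transpose_comp:
  assumes q: "q permutes S" and "m \<notin> S" "b \<in> S" "s \<in> S"
  shows "orbit (Transposition.transpose m b \<circ> q) s - {m} = orbit q s"
proof -
  let ?f = "Transposition.transpose m b \<circ> q"
  have qS: "q x \<in> S \<longleftrightarrow> x \<in> S" for x
    using q by (simp add: permutes_in_image)
  have qm: "q m = m"
    using q assms(2) by (simp add: permutes_not_in)
  have fm: "?f m = b"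
    by (simp add: qm)
  have f1: "?f x = m" if "q x = b" for x
    using that by simp
  have f2: "?f x = q x" if "x \<in> S" "q x \<noteq> b" for x
    using that qS[of x] assms(2) by (auto intro!: transpose_apply_other)
  have sub: "orbit q s \<subseteq> S"
  proof
    fix y assume "y \<in> orbit q s"
    then show "y \<in> S"
      by induction (use assms qS in auto)
  qed
  have fwd: "y \<in> orbit ?f s" if "y \<in> orbit q s" for y
    using that
  proof induction
    case base
    show ?case
    proof (cases "q s = b")
      case True
      then show ?thesis
        using f1[of s] fm by (metis orbit.base orbit.step)
    next
      case False
      then show ?thesis
        using f2[of s] assms(4) by (metis orbit.base)
    qed
  next
    case (step y)
    then have "y \<in> S" using sub by auto
    show ?case
    proof (cases "q y = b")
      case True
      then show ?thesis
        using f1[of y] fm step.IH by (metis orbit.step)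
    next
      case False
      then show ?thesis
        using step.IH f2[OF \<open>y \<in> S\<close>] by (metis orbit.step)
    qed
  qed
  \<comment> \<open>The point \<open>m\<close> lies outside \<open>orbit q s\<close>; when the walk
    visits it, the invariant records \<open>b\<close>, where the walk goes next.\<close>
  have bwd: "if y = m then b \<in> orbit q s else y \<in> orbit q s" if "y \<in> orbit ?f s" for y
    using that
  proof induction
    case base
    then show ?case
      using f1[of s] f2[of s] assms orbit.base[of q s] qS[of s] by (cases "q s = b") auto
  next
    case (step y)
    show ?case
    proof (cases "y = m")
      case True
      then show ?thesis
        using step.IH fm assms by auto
    next
      case False
      then have y: "y \<in> orbit q s" using step.IH by simp
      then have "y \<in> S" using sub by auto
      then show ?thesis
        using f1[of y] f2[of y] orbit.step[OF y] qS[of y] assms by (cases "q y = b") auto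
    qed
  qed
  have "orbit ?f s - {m} \<subseteq> orbit q s"
    using bwd by (metis DiffE singletonI subsetI)
  moreover have "orbit q s \<subseteq> orbit ?f s - {m}"
    using fwd sub assms(2) by blast
  ultimately show ?thesis by blast
qed

text \<open>This is the case of a new cycle: a point outside \<open>S\<close> is fixed, so its orbit
  is a singleton.\<close>

lemma cycle_max_not_in:
  assumes "q permutes S" "m \<notin> S"
  shows "cycle_max q m = 1"
proof -
  have qm: "q m = m"
    using assms by (simp add: permutes_not_in)
  have "y = m" if "y \<in> orbit q m" for y
    using that by induction (simp_all add: qm)
  then have "orbit q m = {m}"
    using orbit.base[of q m] qm by auto
  then show ?thesis
    by (simp add: cycle_max_def)
qed

text \<open>The point \<open>m\<close> shares its cycle with the larger \<open>b\<close>, so it is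
  not the maximum. The other points keep their cycles up to \<open>m\<close>, which lies below all
  of \<open>S\<close> and cannot affect a maximum.\<close>

lemma cycle_max_transpose_comp:
  fixes m :: "'n::linorder"
  assumes "finite S" "q permutes S" "\<forall>s\<in>S. m < s" "b \<in> S"
  shows "cycle_max (Transposition.transpose m b \<circ> q) m = 0"
    and "s \<in> S \<Longrightarrow> cycle_max (Transposition.transpose m b \<circ> q) s = cycle_max q s"
proof -
  let ?f = "Transposition.transpose m b \<circ> q"
  have mS: "m \<notin> S" using assms by auto
  have f: "?f permutes insert m S"
    by (rule permutes_compose[OF permutes_subset[OF assms(2)]])
      (use assms in \<open>auto intro: permutes_swap_id\<close>)
  have "?f m = b"
    using permutes_not_in[OF assms(2) mS] by simp
  then have "b \<in> orbit ?f m"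
    using orbit.base[of ?f m] by simp
  then have "b \<le> Max (orbit ?f m)"
    using finite_orbit_permutes(1)[OF _ f, of m] assms by auto
  then show "cycle_max ?f m = 0"
    using assms by (auto simp: cycle_max_def)
  show "cycle_max ?f s = cycle_max q s" if s: "s \<in> S"
  proof -
    have fin: "finite (orbit ?f s)" "s \<in> orbit ?f s"
      using finite_orbit_permutes[OF _ f, of s] assms s by auto
    have fin': "finite (orbit q s)" "s \<in> orbit q s"
      using finite_orbit_permutes[OF assms(1,2) s] by auto
    have max_iff: "s = Max X \<longleftrightarrow> (\<forall>x\<in>X. x \<le> s)" if "finite X" "s \<in> X" for X
      using that by (metis Max_eqI Max_ge)
    have "(\<forall>x\<in>orbit ?f s. x \<le> s) \<longleftrightarrow> (\<forall>x\<in>orbit ?f s - {m}. x \<le> s)"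
      using assms(3) s by (metis Diff_iff less_imp_le singletonD)
    then show ?thesis
      using max_iff[OF fin] max_iff[OF fin'] orbit_transpose_comp[OF assms(2) mS assms(4) s]
      by (simp add: cycle_max_def)
  qed
qed

text \<open>
  The minimum of the set is either a new cycle or is placed before one of the larger elements
  in an existing cycle, whose maximum does not change.
\<close>

lemma sum_permutes_cycle_max:
  fixes x :: "'n::linorder \<Rightarrow> 'c::comm_semiring_1"
  assumes "finite S"
  shows "(\<Sum>\<sigma> | \<sigma> permutes S. \<Prod>s\<in>S. x s ^ cycle_max \<sigma> s) =
    (\<Prod>s\<in>S. x s + of_nat (card {t \<in> S. s < t}))"
  using assms
proof (induction S rule: finite_linorder_min_induct)
  case empty
  then show ?case by simp
next
  case (insert m S)
  let ?P = "\<lambda>\<sigma>. \<Prod>s\<in>S. x s ^ cycle_max \<sigma> s"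
  have mS: "m \<notin> S" using insert by auto
  have "(\<Sum>\<sigma> | \<sigma> permutes insert m S. \<Prod>s\<in>insert m S. x s ^ cycle_max \<sigma> s) =
      (\<Sum>b\<in>insert m S. \<Sum>q | q permutes S. \<Prod>s\<in>insert m S. x s ^ cycle_max (Transposition.transpose m b \<circ> q) s)"
    by (rule sum_over_permutations_insert[OF insert(1) mS])
  \<comment> \<open>For \<open>b = m\<close> the transposition is the identity, and \<open>m\<close>
    contributes the factor \<open>x m\<close>. Each \<open>b\<close> in \<open>S\<close> gives
    exponent 0 at \<open>m\<close> and the same sum, hence \<open>card S\<close> copies.\<close>
  also have "\<dots> = (\<Sum>q | q permutes S. x m * ?P q) + (\<Sum>b\<in>S. \<Sum>q | q permutes S. ?P q)"
  proof -
    have "(\<Prod>s\<in>insert m S. x s ^ cycle_max (Transposition.transpose m b \<circ> q) s) = ?P q"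
      if "b \<in> S" "q permutes S" for b q
      using insert that mS by (simp add: cycle_max_transpose_comp)
    then show ?thesis
      using insert mS by (simp add: cycle_max_not_in)
  qed
  also have "\<dots> = (x m + of_nat (card S)) * (\<Prod>s\<in>S. x s + of_nat (card {t \<in> S. s < t}))"
    by (simp add: sum_distrib_left[symmetric] insert.IH distrib_right)
  also have "\<dots> = (\<Prod>s\<in>insert m S. x s + of_nat (card {t \<in> insert m S. s < t}))"
  proof -
    have "{t \<in> insert m S. m < t} = S" using insert by auto
    moreover have "{t \<in> insert m S. s < t} = {t \<in> S. s < t}" if "s \<in> S" for s
      using insert that by auto
    ultimately show ?thesis
      using insert mS by simp
  qed
  finally show ?case .
qed

text \<open>In an increasing sequence exactly \<open>k - a\<close> entries exceed the one at
  position \<open>a\<close>, so the counts of larger elements become the shifts of the column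
  determinant.\<close>

lemma sum_Gam:
  fixes i :: "nat \<Rightarrow> 'n::{finite,linorder}"
  assumes "strict_mono_on {1..k} i"
  shows "(\<Sum>\<sigma> | \<sigma> permutes (i ` {1..k}). Gam \<sigma> \<mu> k i) =
    (\<Prod>a = 1..k. schur_weight \<mu> (i a) + of_nat (k - a))"
proof -
  have inj: "inj_on i {1..k}"
    using assms by (rule strict_mono_on_imp_inj_on)
  have card_eq: "card {t \<in> i ` {1..k}. i a < t} = k - a" if "a \<in> {1..k}" for a
  proof -
    have "{t \<in> i ` {1..k}. i a < t} = i ` {a<..k}"
      using strict_mono_on_less[OF assms that] that by fastforce
    moreover have "inj_on i {a<..k}"
      using inj by (rule inj_on_subset) auto
    ultimately show ?thesis
      by (simp add: card_image)
  qed
  have "Gam \<sigma> \<mu> k i = (\<Prod>s\<in>i ` {1..k}. schur_weight \<mu> s ^ cycle_max \<sigma> s)" for \<sigma>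
    unfolding Gam_def by (subst prod.reindex[OF inj]) simp
  then have "(\<Sum>\<sigma> | \<sigma> permutes (i ` {1..k}). Gam \<sigma> \<mu> k i) =
      (\<Prod>s\<in>i ` {1..k}. schur_weight \<mu> s + of_nat (card {t \<in> i ` {1..k}. s < t}))"
    by (simp add: sum_permutes_cycle_max)
  also have "\<dots> = (\<Prod>a = 1..k. schur_weight \<mu> (i a) + of_nat (k - a))"
    unfolding prod.reindex[OF inj] by (rule prod.cong[OF refl]) (simp only: comp_apply card_eq)
  finally show ?thesis .
qed

section \<open>Column determinants over \<open>gl(n)\<close>\<close>

text \<open>Removing one pair \<open>x\<close>, \<open>T x\<close> at a time gives the result in any
  abelian group, where \<open>2 * s = 0\<close> would not force \<open>s = 0\<close>.\<close>

lemma sum_involution_cancel: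
  fixes f :: "'b \<Rightarrow> 'a::ab_group_add"
  assumes "finite S"
    and "\<And>x. x \<in> S \<Longrightarrow> T x \<in> S" "\<And>x. x \<in> S \<Longrightarrow> T (T x) = x" "\<And>x. x \<in> S \<Longrightarrow> T x \<noteq> x"
    and "\<And>x. x \<in> S \<Longrightarrow> f (T x) = - f x"
  shows "sum f S = 0"
  using assms
proof (induction "card S" arbitrary: S rule: less_induct)
  case less
  show ?case
  proof (cases "S = {}")
    case False
    then obtain x where x: "x \<in> S" by auto
    note Tx = less.prems(2-5)[OF x]
    have "sum f (S - {x, T x}) = 0"
    proof (rule less.hyps)
      show "card (S - {x, T x}) < card S"
        using less.prems(1) x by (auto intro: psubset_card_mono)
      show "T y \<in> S - {x, T x}" if "y \<in> S - {x, T x}" for y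
        using that less.prems(2,3) x by (metis Diff_iff insert_iff empty_iff)
    qed (use less.prems in auto)
    moreover have "sum f S = sum f (S - {x, T x}) + sum f {x, T x}"
      using less.prems(1) x Tx by (subst sum.subset_diff[of "{x, T x}"]) auto
    ultimately show ?thesis
      using Tx by simp
  qed simp
qed

text \<open>Bracketing with \<open>e\<close> is a derivation, and this is its Leibniz rule.
  Distinctness ensures that an update of \<open>f\<close> at \<open>l\<close> changes a single
  factor.\<close>

lemma prod_list_commutator:
  fixes e :: "'a::ring_1"
  assumes "distinct xs"
  shows "e * prod_list (map f xs) - prod_list (map f xs) * e =
    (\<Sum>l\<in>set xs. prod_list (map (f(l := e * f l - f l * e)) xs))"
  using assms
proof (induction xs)
  case (Cons x xs)
  let ?P = "prod_list (map f xs)" and ?d = "\<lambda>l. f(l := e * f l - f l * e)"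
  have "map (?d x) xs = map f xs"
    using Cons.prems by (intro map_cong) auto
  then have "prod_list (map (?d x) (x # xs)) = (e * f x - f x * e) * ?P"
    by (simp only: list.map prod_list.Cons fun_upd_same)
  moreover have "(\<Sum>l\<in>set xs. prod_list (map (?d l) (x # xs))) =
      f x * (\<Sum>l\<in>set xs. prod_list (map (?d l) xs))"
    unfolding sum_distrib_left by (rule sum.cong) (use Cons.prems in auto)
  moreover have "(\<Sum>l\<in>set xs. prod_list (map (?d l) xs)) = e * ?P - ?P * e"
    using Cons by (simp del: fun_upd_apply)
  ultimately have "(\<Sum>l\<in>set (x # xs). prod_list (map (?d l) (x # xs))) =
      (e * f x - f x * e) * ?P + f x * (e * ?P - ?P * e)"
    using Cons.prems by (simp only: list.set sum.insert finite_set distinct.simps not_False_eq_True)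
  then show ?case
    by (simp add: algebra_simps del: fun_upd_apply)
qed simp

lemma prod_list_fun_upd_diff:
  fixes f :: "'b \<Rightarrow> 'a::ring_1"
  assumes "distinct xs" "l \<in> set xs"
  shows "prod_list (map (f(l := y - z)) xs) =
    prod_list (map (f(l := y)) xs) - prod_list (map (f(l := z)) xs)"
proof -
  obtain us vs where xs: "xs = us @ l # vs"
    using assms(2) by (meson split_list)
  have eq: "map (f(l := w)) us = map f us" "map (f(l := w)) vs = map f vs" for w
    using assms(1) xs by (auto intro!: map_cong)
  show ?thesis
    unfolding xs map_append list.map eq by (simp add: algebra_simps)
qed

section \<open>Sorting injective tuples\<close>

text \<open>Here \<open>\<tau> j\<close> is the rank of \<open>a j\<close> among the entries, so
  undoing \<open>\<tau>\<close> lists the entries in increasing order.\<close>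

lemma permutes_sorting:
  fixes a :: "nat \<Rightarrow> 'n::linorder"
  assumes "inj_on a {1..k}"
  defines "\<tau> \<equiv> \<lambda>j. if j \<in> {1..k} then card {x \<in> {1..k}. a x \<le> a j} else j"
  shows "\<tau> permutes {1..k}" and "strict_mono_on {1..k} (a \<circ> inv \<tau>)"
proof -
  have less: "\<tau> x < \<tau> y" if "x \<in> {1..k}" "y \<in> {1..k}" "a x < a y" for x y
  proof -
    have "{z \<in> {1..k}. a z \<le> a x} \<subset> {z \<in> {1..k}. a z \<le> a y}"
      using that by (auto simp: less_le_not_le)
    then show ?thesis
      using that by (simp add: \<tau>_def psubset_card_mono)
  qed
  have inj: "inj_on \<tau> {1..k}"
    using less assms(1) by (metis (no_types, lifting) inj_on_def less_irrefl linorder_less_linear)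
  have into: "\<tau> j \<in> {1..k}" if "j \<in> {1..k}" for j
  proof -
    have "{j} \<subseteq> {x \<in> {1..k}. a x \<le> a j}" "{x \<in> {1..k}. a x \<le> a j} \<subseteq> {1..k}"
      using that by auto
    from card_mono[OF _ this(1)] card_mono[OF _ this(2)] show ?thesis
      using that by (simp add: \<tau>_def)
  qed
  have "\<tau> ` {1..k} = {1..k}"
    by (rule endo_inj_surj[OF _ _ inj]) (use into in auto)
  then show perm: "\<tau> permutes {1..k}"
    by (intro bij_imp_permutes) (use inj in \<open>auto simp: bij_betw_def \<tau>_def\<close>)
  show "strict_mono_on {1..k} (a \<circ> inv \<tau>)"
  proof (rule strict_mono_onI)
    fix r s assume rs: "r \<in> {1..k}" "s \<in> {1..k}" "r < s"
    have "inv \<tau> r \<in> {1..k}" "inv \<tau> s \<in> {1..k}"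
      using rs permutes_in_image[OF permutes_inv[OF perm]] by blast+
    moreover have "\<tau> (inv \<tau> r) = r" "\<tau> (inv \<tau> s) = s"
      using permutes_inverses[OF perm] by auto
    ultimately show "(a \<circ> inv \<tau>) r < (a \<circ> inv \<tau>) s"
      using less[of "inv \<tau> s" "inv \<tau> r"] rs assms(1)
      by (metis comp_apply less_asym less_irrefl linorder_less_linear inj_on_eq_iff)
  qed
qed

text \<open>An increasing \<open>i\<close> does not change comparisons, so the rank of the entry at
  \<open>j\<close> in \<open>i \<circ> \<tau>\<close> is \<open>\<tau> j\<close>. Thus the tuple
  determines \<open>\<tau>\<close>, which yields injectivity in the bijection below.\<close>

lemma sorting_permutation_unique:
  fixes i :: "nat \<Rightarrow> 'n::linorder"
  assumes i: "strict_mono_on {1..k} i" and \<tau>: "\<tau> permutes {1..k}"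
  shows "\<tau> = (\<lambda>j. if j \<in> {1..k} then card {x \<in> {1..k}. (i \<circ> \<tau>) x \<le> (i \<circ> \<tau>) j} else j)"
  unfolding comp_apply
proof
  fix j
  show "\<tau> j = (if j \<in> {1..k} then card {x \<in> {1..k}. i (\<tau> x) \<le> i (\<tau> j)} else j)"
  proof (cases "j \<in> {1..k}")
    case True
    have in_range: "\<tau> x \<in> {1..k} \<longleftrightarrow> x \<in> {1..k}" for x
      by (rule permutes_in_image[OF \<tau>])
    have "{x \<in> {1..k}. i (\<tau> x) \<le> i (\<tau> j)} = {x \<in> {1..k}. \<tau> x \<le> \<tau> j}"
      using strict_mono_on_leD[OF i] i True in_range strict_mono_on_less_eq[OF i] by blast
    also have "\<dots> = \<tau> -` {1..\<tau> j}"
    proof -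
      have "\<tau> x \<in> {1..\<tau> j} \<longleftrightarrow> x \<in> {1..k} \<and> \<tau> x \<le> \<tau> j" for x
        using in_range[of x] in_range[of j] True by auto
      then show ?thesis by blast
    qed
    finally have "card {x \<in> {1..k}. i (\<tau> x) \<le> i (\<tau> j)} = card {1..\<tau> j}"
      using permutes_inj[OF \<tau>] permutes_surj[OF \<tau>] by (simp only: card_vimage_inj subset_UNIV)
    then show ?thesis
      using True by simp
  next
    case False
    then show ?thesis
      using permutes_not_in[OF \<tau> False] by (simp only: if_False)
  qed
qed

lemma bij_betw_increasing_seqs_permutes:
  "bij_betw (\<lambda>(i, \<tau>). i \<circ> \<tau>)
    ((increasing_seqs k :: (nat \<Rightarrow> 'n::{finite,linorder}) set) \<times> {\<tau>. \<tau> permutes {1..k}})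
    {a \<in> {1..k} \<rightarrow>\<^sub>E UNIV. inj_on a {1..k}}"
  unfolding bij_betw_def
proof (intro conjI)
  let ?D = "(increasing_seqs k :: (nat \<Rightarrow> 'n) set) \<times> {\<tau>. \<tau> permutes {1..k}}"
  show "inj_on (\<lambda>(i, \<tau>). i \<circ> \<tau>) ?D"
  proof (rule inj_onI, clarify)
    fix i i' :: "nat \<Rightarrow> 'n" and \<tau> \<tau>'
    assume *: "i \<in> increasing_seqs k" "i' \<in> increasing_seqs k" "\<tau> permutes {1..k}"
      "\<tau>' permutes {1..k}" and eq: "i \<circ> \<tau> = i' \<circ> \<tau>'"
    let ?sort = "\<lambda>(a :: nat \<Rightarrow> 'n) j. if j \<in> {1..k} then card {x \<in> {1..k}. a x \<le> a j} else j"
    have mono: "strict_mono_on {1..k} i" "strict_mono_on {1..k} i'"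
      using * by (auto simp: increasing_seqs_def)
    have "\<tau> = ?sort (i \<circ> \<tau>)"
      by (rule sorting_permutation_unique[OF mono(1) *(3)])
    also have "\<dots> = ?sort (i' \<circ> \<tau>')"
      by (simp only: eq)
    also have "\<dots> = \<tau>'"
      by (rule sorting_permutation_unique[OF mono(2) *(4), symmetric])
    finally have "\<tau> = \<tau>'" .
    moreover have "i = (i \<circ> \<tau>) \<circ> inv \<tau>" "i' = (i' \<circ> \<tau>') \<circ> inv \<tau>'"
      using * by (simp_all add: comp_assoc permutes_inv_o)
    ultimately show "i = i' \<and> \<tau> = \<tau>'"
      using eq by simp
  qed
  show "(\<lambda>(i, \<tau>). i \<circ> \<tau>) ` ?D = {a \<in> {1..k} \<rightarrow>\<^sub>E UNIV. inj_on a {1..k}}"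
  proof (intro equalityI subsetI)
    fix a assume "a \<in> (\<lambda>(i, \<tau>). i \<circ> \<tau>) ` ?D"
    then obtain i \<tau> where a: "a = i \<circ> \<tau>" "i \<in> increasing_seqs k" "\<tau> permutes {1..k}"
      by auto
    then have "inj_on i {1..k}"
      by (auto simp: increasing_seqs_def intro: strict_mono_on_imp_inj_on)
    then have "inj_on a {1..k}"
      using a permutes_inj_on[OF a(3), of "{1..k}"] by (simp add: comp_inj_on permutes_image)
    \<comment> \<open>Outside \<open>{1..k}\<close> the permutation fixes the argument, so the
      default value of \<open>i\<close> is inherited.\<close>
    moreover have "a \<in> {1..k} \<rightarrow>\<^sub>E UNIV"
      using a by (auto simp: increasing_seqs_def PiE_def extensional_def permutes_not_in)
    ultimately show "a \<in> {a \<in> {1..k} \<rightarrow>\<^sub>E UNIV. inj_on a {1..k}}" by simp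
  next
    fix a :: "nat \<Rightarrow> 'n" assume a: "a \<in> {a \<in> {1..k} \<rightarrow>\<^sub>E UNIV. inj_on a {1..k}}"
    then obtain \<tau> where \<tau>: "\<tau> permutes {1..k}" "strict_mono_on {1..k} (a \<circ> inv \<tau>)"
      using permutes_sorting[of a k] by blast
    have "a \<circ> inv \<tau> \<in> {1..k} \<rightarrow>\<^sub>E UNIV"
      using a permutes_not_in[OF permutes_inv[OF \<tau>(1)]] by (auto simp: PiE_def extensional_def)
    then have "(a \<circ> inv \<tau>, \<tau>) \<in> ?D"
      using \<tau> by (simp add: increasing_seqs_def)
    moreover have "a = (a \<circ> inv \<tau>) \<circ> \<tau>"
      using \<tau> by (simp add: comp_assoc permutes_inv_o)
    ultimately show "a \<in> (\<lambda>(i, \<tau>). i \<circ> \<tau>) ` ?D"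
      by (metis (no_types, lifting) case_prod_conv image_eqI)
  qed
qed

section \<open>Shifted column determinants and their symmetries\<close>

text \<open>The determinant identities rest on the commutation relations of matrix units alone, so
  they are stated for any ring with such elements and later applied to \<open>e_gen\<close>.\<close>

locale gl_generators =
  fixes E :: "'n::{finite,linorder} \<Rightarrow> 'n \<Rightarrow> 'a::ring_1"
  assumes E_commutator: "E i j * E p q - E p q * E i j =
    (if j = p then E i q else 0) - (if i = q then E p j else 0)"
begin

text \<open>The scalar appears when the index values agree, not the positions. This gives it a
  meaning for tuples with repetitions.\<close>

definition shifted :: "nat \<Rightarrow> 'n \<Rightarrow> 'n \<Rightarrow> 'a"
  where "shifted u x y = E x y + (if x = y then of_nat u else 0)"

text \<open>The shift depends on the column position only and falls from \<open>k - 1\<close> to 0,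
  left to right.\<close>

definition colprod :: "nat \<Rightarrow> (nat \<Rightarrow> 'n) \<Rightarrow> (nat \<Rightarrow> 'n) \<Rightarrow> 'a"
  where "colprod k x y = prod_list (map (\<lambda>j. shifted (k - j) (x j) (y j)) [1..<Suc k])"

definition minor :: "nat \<Rightarrow> (nat \<Rightarrow> 'n) \<Rightarrow> (nat \<Rightarrow> 'n) \<Rightarrow> 'a"
  where "minor k a b = (\<Sum>\<sigma> | \<sigma> permutes {1..k}. of_int (sign \<sigma>) * colprod k (a \<circ> \<sigma>) b)"

text \<open>The scalar \<open>u\<close> is central. Writing the two terms of the bracket with
  shifted entries adds \<open>u\<close> to both when \<open>q = x\<close> and \<open>p = y\<close>,
  where it cancels, and changes nothing otherwise.\<close>

lemma shifted_commutator:
  "E p q * shifted u x y - shifted u x y * E p q =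
    (if q = x then shifted u p y else 0) - (if p = y then shifted u x q else 0)"
  using E_commutator[of p q x y]
  by (auto simp: shifted_def algebra_simps mult_of_nat_commute split: if_splits)

text \<open>The decrease of the shift by one compensates the commutators.\<close>

lemma shifted_swap:
  "shifted (Suc w) x b * shifted w y c + shifted (Suc w) x c * shifted w y b =
    shifted (Suc w) y b * shifted w x c + shifted (Suc w) y c * shifted w x b"
proof -
  have [simp]: "E i j * of_nat w = of_nat w * E i j" for i j
    by (simp add: mult_of_nat_commute)
  have "(shifted (Suc w) x b * shifted w y c + shifted (Suc w) x c * shifted w y b) -
      (shifted (Suc w) y b * shifted w x c + shifted (Suc w) y c * shifted w x b) =
      (E x b * E y c - E y c * E x b) + (E x c * E y b - E y b * E x c) +
      ((if x = b then E y c else 0) - (if y = c then E x b else 0) +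
       (if x = c then E y b else 0) - (if y = b then E x c else 0))"
    by (simp add: shifted_def algebra_simps)
  also have "\<dots> = 0"
    unfolding E_commutator by auto
  finally show ?thesis
    by simp
qed

text \<open>The Leibniz rule brackets one factor at a time, and the bracket of an entry is a
  difference of entries with the same shift, so both terms are again column products.\<close>

lemma colprod_commutator:
  "E p q * colprod k x y - colprod k x y * E p q =
    (\<Sum>l = 1..k. (if q = x l then colprod k (x(l := p)) y else 0) -
      (if p = y l then colprod k x (y(l := q)) else 0))"
proof -
  let ?f = "\<lambda>x y j. shifted (k - j) (x j) (y j)" and ?xs = "[1..<Suc k]"
  have upd: "?f (x(l := z)) y = (?f x y)(l := shifted (k - l) z (y l))"
    "?f x (y(l := z)) = (?f x y)(l := shifted (k - l) (x l) z)" for x y l z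
    by auto
  have "prod_list (map ((?f x y)(l := E p q * ?f x y l - ?f x y l * E p q)) ?xs) =
      (if q = x l then colprod k (x(l := p)) y else 0) -
      (if p = y l then colprod k x (y(l := q)) else 0)" if "l \<in> {1..k}" for l
  proof -
    have l: "l \<in> set ?xs" using that by auto
    \<comment> \<open>A zero factor kills the product: this is additivity in that factor, applied to
      \<open>0 - 0\<close>.\<close>
    have 0: "prod_list (map ((?f x y)(l := 0)) ?xs) = 0"
      using prod_list_fun_upd_diff[OF distinct_upt l, of "?f x y" 0 0] by (simp del: fun_upd_apply)
    show ?thesis
      unfolding colprod_def upd shifted_commutator prod_list_fun_upd_diff[OF distinct_upt l]
      using 0 by (simp del: fun_upd_apply)
  qed
  then show ?thesis
    unfolding colprod_def prod_list_commutator[OF distinct_upt]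
    by (intro sum.cong) auto
qed

text \<open>All four products agree outside the columns \<open>j\<close> and \<open>Suc j\<close>,
  whose shifts differ by one, so \<open>shifted_swap\<close> applies between common outer
  factors.\<close>

lemma colprod_adjacent_swap:
  assumes j: "1 \<le> j" "j < k"
  defines "t \<equiv> Transposition.transpose j (Suc j)"
  shows "colprod k x y + colprod k x (y \<circ> t) = colprod k (x \<circ> t) y + colprod k (x \<circ> t) (y \<circ> t)"
proof -
  let ?us = "[1..<j]" and ?vs = "[Suc (Suc j)..<Suc k]"
  let ?f = "\<lambda>x y j. shifted (k - j) (x j) (y j)"
  let ?L = "prod_list (map (?f x y) ?us)" and ?R = "prod_list (map (?f x y) ?vs)"
  \<comment> \<open>This is the shift of column \<open>Suc j\<close>. Since \<open>j < k\<close>,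
    the subtraction does not truncate, and column \<open>j\<close> has shift
    \<open>Suc w\<close>.\<close>
  define w where "w = k - Suc j"
  have w: "k - j = Suc w" "k - Suc j = w"
    using j by (simp_all add: w_def)
  have "[1..<Suc k] = [1..<j] @ [j..<Suc k]"
    using j upt_add_eq_append[of 1 j "Suc k - j"] by simp
  then have upt: "[1..<Suc k] = ?us @ j # Suc j # ?vs"
    using j by (simp add: upt_conv_Cons)
  have *: "colprod k x' y' = ?L * (shifted (Suc w) (x' j) (y' j) *
      shifted w (x' (Suc j)) (y' (Suc j))) * ?R"
    if "\<And>l. l \<noteq> j \<Longrightarrow> l \<noteq> Suc j \<Longrightarrow> x' l = x l \<and> y' l = y l" for x' y'
  proof -
    have eq: "map (?f x' y') ?us = map (?f x y) ?us" "map (?f x' y') ?vs = map (?f x y) ?vs"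
      using that by (auto intro!: map_cong)
    show ?thesis
      unfolding colprod_def upt map_append list.map eq w by (simp add: mult.assoc)
  qed
  have t: "t j = Suc j" "t (Suc j) = j" "\<And>l. l \<noteq> j \<Longrightarrow> l \<noteq> Suc j \<Longrightarrow> t l = l"
    by (simp_all add: t_def)
  have "colprod k x y + colprod k x (y \<circ> t) = ?L * (shifted (Suc w) (x j) (y j) *
      shifted w (x (Suc j)) (y (Suc j)) + shifted (Suc w) (x j) (y (Suc j)) *
      shifted w (x (Suc j)) (y j)) * ?R"
    by (simp add: *[of x y] *[of x "y \<circ> t"] t distrib_left distrib_right)
  also have "\<dots> = colprod k (x \<circ> t) y + colprod k (x \<circ> t) (y \<circ> t)"
    by (subst shifted_swap)
      (simp add: *[of "x \<circ> t" y] *[of "x \<circ> t" "y \<circ> t"] t distrib_left distrib_right)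
  finally show ?thesis .
qed

text \<open>The sum of the products for \<open>b\<close> and for the swapped \<open>b\<close> is
  unchanged when the rows are swapped as well, while the sign flips. Pairing \<open>\<sigma>\<close>
  with \<open>\<sigma> \<circ> ?t\<close> therefore makes the two minors add up to 0.\<close>

lemma minor_adjacent_col_swap:
  assumes j: "1 \<le> j" "j < k"
  shows "minor k a (b \<circ> Transposition.transpose j (Suc j)) = - minor k a b"
proof -
  let ?t = "Transposition.transpose j (Suc j)"
  let ?g = "\<lambda>\<sigma>. of_int (sign \<sigma>) * (colprod k (a \<circ> \<sigma>) b + colprod k (a \<circ> \<sigma>) (b \<circ> ?t))"
  have tt: "?t \<circ> ?t = id" and t: "?t permutes {1..k}" "permutation ?t" "sign ?t = -1"
    using j by (auto simp: permutes_swap_id permutation_swap_id sign_swap_id)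
  have "sum ?g {\<sigma>. \<sigma> permutes {1..k}} = 0"
  proof (rule sum_involution_cancel[where T = "\<lambda>\<sigma>. \<sigma> \<circ> ?t"])
    fix \<sigma> assume "\<sigma> \<in> {\<sigma>. \<sigma> permutes {1..k}}"
    then have \<sigma>: "\<sigma> permutes {1..k}" "permutation \<sigma>"
      by (auto simp: permutation_permutes)
    show "\<sigma> \<circ> ?t \<in> {\<sigma>. \<sigma> permutes {1..k}}"
      using permutes_compose[OF t(1) \<sigma>(1)] by simp
    show "\<sigma> \<circ> ?t \<circ> ?t = \<sigma>"
      by (simp add: comp_assoc tt)
    show "\<sigma> \<circ> ?t \<noteq> \<sigma>"
    proof
      assume "\<sigma> \<circ> ?t = \<sigma>"
      then have "\<sigma> (Suc j) = \<sigma> j"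
        by (metis comp_apply transpose_apply_first)
      then show False
        by (simp add: inj_eq[OF permutes_inj[OF \<sigma>(1)]])
    qed
    show "?g (\<sigma> \<circ> ?t) = - ?g \<sigma>"
      using colprod_adjacent_swap[OF j, of "a \<circ> \<sigma>" b]
      by (simp add: sign_compose[OF \<sigma>(2) t(2)] t(3) comp_assoc)
  qed (simp add: finite_permutations)
  then show ?thesis
    by (simp add: minor_def distrib_left sum.distrib eq_neg_iff_add_eq_0 add.commute)
qed

text \<open>A longer transposition is the conjugate of a shorter one by an adjacent one, which
  changes the sign three times.\<close>

lemma minor_col_transpose:
  assumes "1 \<le> i" "i < j" "j \<le> k"
  shows "minor k a (b \<circ> Transposition.transpose i j) = - minor k a b"
proof -
  have "Suc i \<le> j" using assms by simp
  then show ?thesis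
    using assms(3)
  proof (induction j arbitrary: b rule: dec_induct)
    case base
    then show ?case
      using assms by (intro minor_adjacent_col_swap) auto
  next
    case (step j)
    let ?t = "Transposition.transpose j (Suc j)" and ?s = "Transposition.transpose i j"
    have "Transposition.transpose i (Suc j) = ?t \<circ> ?s \<circ> ?t"
      using step by (auto simp: fun_eq_iff Transposition.transpose_def)
    then have "minor k a (b \<circ> Transposition.transpose i (Suc j)) = minor k a ((b \<circ> ?t \<circ> ?s) \<circ> ?t)"
      by (simp add: comp_assoc)
    also have "\<dots> = - minor k a b"
      using step assms by (simp only: minor_adjacent_col_swap minus_minus)
    finally show ?case .
  qed
qed

lemma minor_col_permute:
  assumes "\<tau> permutes {1..k}"
  shows "minor k a (b \<circ> \<tau>) = of_int (sign \<tau>) * minor k a b"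
  using assms finite_atLeastAtMost
proof (induction \<tau> arbitrary: b rule: permutes_induct)
  case id
  then show ?case by simp
next
  case (swap i j p)
  let ?t = "Transposition.transpose i j"
  have p: "permutation p" "permutation ?t"
    using swap permutation_swap_id[of i j] by (auto simp only: permutation_permutes)
  have eq: "minor k a (b \<circ> ?t) = of_int (sign ?t) * minor k a b"
    using swap minor_col_transpose[of i j k a b] minor_col_transpose[of j i k a b]
    by (cases i j rule: linorder_cases) (auto simp: sign_swap_id transpose_commute)
  have "minor k a (b \<circ> (?t \<circ> p)) = minor k a ((b \<circ> ?t) \<circ> p)"
    by (simp only: comp_assoc)
  also have "\<dots> = of_int (sign p) * minor k a (b \<circ> ?t)"
    by (rule swap)
  also have "\<dots> = of_int (sign (?t \<circ> p)) * minor k a b"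
    by (simp only: eq sign_compose[OF p(2,1)] mult.commute[of "sign ?t" "sign p"] of_int_mult
        mult.assoc)
  finally show ?case .
qed

text \<open>Permuting rows leaves the order of the factors alone, so reindexing the sum by
  \<open>\<tau> \<circ> \<sigma>\<close> suffices, as for a commutative determinant.\<close>

lemma minor_row_permute:
  assumes \<tau>: "\<tau> permutes {1..k}"
  shows "minor k (a \<circ> \<tau>) b = of_int (sign \<tau>) * minor k a b"
proof -
  have "minor k a b =
      (\<Sum>\<sigma> | \<sigma> permutes {1..k}. of_int (sign (\<tau> \<circ> \<sigma>)) * colprod k (a \<circ> (\<tau> \<circ> \<sigma>)) b)"
    unfolding minor_def by (rule setum_permutations_compose_left[OF \<tau>])
  also have "\<dots> = (\<Sum>\<sigma> | \<sigma> permutes {1..k}.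
      of_int (sign \<tau>) * (of_int (sign \<sigma>) * colprod k (a \<circ> \<tau> \<circ> \<sigma>) b))"
  proof (rule sum.cong[OF refl])
    fix \<sigma> assume "\<sigma> \<in> {\<sigma>. \<sigma> permutes {1..k}}"
    then have "sign (\<tau> \<circ> \<sigma>) = sign \<tau> * sign \<sigma>"
      using \<tau> by (intro sign_compose) (auto simp: permutation_permutes)
    then show "of_int (sign (\<tau> \<circ> \<sigma>)) * colprod k (a \<circ> (\<tau> \<circ> \<sigma>)) b =
        of_int (sign \<tau>) * (of_int (sign \<sigma>) * colprod k (a \<circ> \<tau> \<circ> \<sigma>) b)"
      by (simp add: comp_assoc mult.assoc)
  qed
  also have "\<dots> = of_int (sign \<tau>) * minor k (a \<circ> \<tau>) b"
    by (simp add: minor_def sum_distrib_left)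
  finally show ?thesis
    by (simp add: mult.assoc[symmetric] of_int_mult[symmetric] del: of_int_mult)
qed

text \<open>Swapping two positions with equal row index fixes \<open>a\<close>, so permutations pair
  off with equal products and opposite signs.\<close>

lemma minor_not_inj:
  assumes "\<not> inj_on a {1..k}"
  shows "minor k a b = 0"
proof -
  obtain p q where pq: "p \<in> {1..k}" "q \<in> {1..k}" "p \<noteq> q" "a p = a q"
    using assms by (auto simp: inj_on_def)
  let ?t = "Transposition.transpose p q"
  have tt: "?t \<circ> ?t = id" and t: "?t permutes {1..k}" "permutation ?t" "sign ?t = -1"
    using pq by (auto simp: permutes_swap_id permutation_swap_id sign_swap_id)
  have at: "a \<circ> ?t = a"
    using pq by (auto simp: fun_eq_iff Transposition.transpose_def)
  show ?thesis
    unfolding minor_def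
  proof (rule sum_involution_cancel[where T = "\<lambda>\<sigma>. ?t \<circ> \<sigma>"])
    fix \<sigma> assume "\<sigma> \<in> {\<sigma>. \<sigma> permutes {1..k}}"
    then have \<sigma>: "\<sigma> permutes {1..k}" "permutation \<sigma>"
      by (auto simp: permutation_permutes)
    show "?t \<circ> \<sigma> \<in> {\<sigma>. \<sigma> permutes {1..k}}"
      using permutes_compose[OF \<sigma>(1) t(1)] by simp
    show "?t \<circ> (?t \<circ> \<sigma>) = \<sigma>"
      by (simp add: comp_assoc[symmetric] tt)
    show "?t \<circ> \<sigma> \<noteq> \<sigma>"
    proof
      assume "?t \<circ> \<sigma> = \<sigma>"
      then have "?t (\<sigma> (inv \<sigma> p)) = \<sigma> (inv \<sigma> p)"
        by (metis comp_apply)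
      then show False
        using pq by (simp add: permutes_inverses[OF \<sigma>(1)])
    qed
    show "of_int (sign (?t \<circ> \<sigma>)) * colprod k (a \<circ> (?t \<circ> \<sigma>)) b =
        - (of_int (sign \<sigma>) * colprod k (a \<circ> \<sigma>) b)"
      by (simp add: sign_compose[OF t(2) \<sigma>(2)] t(3) comp_assoc[symmetric] at)
  qed (simp add: finite_permutations)
qed

section \<open>Summation over all tuples and centrality\<close>

text \<open>Tuples with repetitions contribute 0; each increasing sequence has \<open>fact k\<close>
  rearrangements, for which the row sign and the column sign cancel. The full set of tuples is
  stable under changing one entry, which the commutator computation requires.\<close>

lemma sum_minor_all_tuples:
  "(\<Sum>a\<in>{1..k} \<rightarrow>\<^sub>E UNIV. minor k a a) = of_nat (fact k) * (\<Sum>i\<in>increasing_seqs k. minor k i i)"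
proof -
  let ?T = "{1..k} \<rightarrow>\<^sub>E (UNIV :: 'n set)"
  have "(\<Sum>a\<in>?T. minor k a a) = (\<Sum>a\<in>{a \<in> ?T. inj_on a {1..k}}. minor k a a)"
    by (rule sum.mono_neutral_right) (auto simp: finite_PiE minor_not_inj)
  also have "\<dots> = (\<Sum>(i, \<tau>)\<in>increasing_seqs k \<times> {\<tau>. \<tau> permutes {1..k}}. minor k (i \<circ> \<tau>) (i \<circ> \<tau>))"
    using sum.reindex_bij_betw[OF bij_betw_increasing_seqs_permutes, of "\<lambda>a. minor k a a" k]
    by (simp add: case_prod_unfold)
  also have "\<dots> = (\<Sum>(i, \<tau>)\<in>increasing_seqs k \<times> {\<tau>. \<tau> permutes {1..k}}. minor k i i)"
  proof (rule sum.cong[OF refl], clarify)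
    fix i :: "nat \<Rightarrow> 'n" and \<tau> :: "nat \<Rightarrow> nat" assume "\<tau> permutes {1..k}"
    then show "minor k (i \<circ> \<tau>) (i \<circ> \<tau>) = minor k i i"
      by (simp add: minor_col_permute minor_row_permute mult.assoc[symmetric]
          of_int_mult[symmetric] del: of_int_mult)
  qed
  also have "\<dots> = of_nat (fact k) * (\<Sum>i\<in>increasing_seqs k. minor k i i)"
    by (simp add: sum.cartesian_product[symmetric] card_permutations sum_distrib_left)
  finally show ?thesis .
qed

text \<open>
  Bracketing with \<open>E p q\<close> replaces a row index \<open>q\<close> by \<open>p\<close> and, with a minus sign, a column
  index \<open>p\<close> by \<open>q\<close>. Over all tuples, the two families of terms are exchanged by
  \<open>a \<mapsto> a(m := p)\<close>.
\<close>

lemma sum_colprod_commutes: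
  assumes \<sigma>: "\<sigma> permutes {1..k}"
  shows "E p q * (\<Sum>a\<in>{1..k} \<rightarrow>\<^sub>E UNIV. colprod k (a \<circ> \<sigma>) a) =
    (\<Sum>a\<in>{1..k} \<rightarrow>\<^sub>E UNIV. colprod k (a \<circ> \<sigma>) a) * E p q"
proof -
  let ?T = "{1..k} \<rightarrow>\<^sub>E (UNIV :: 'n set)"
  have fin: "finite ?T" by (simp add: finite_PiE)
  have "(\<Sum>a\<in>?T. \<Sum>l = 1..k. if q = (a \<circ> \<sigma>) l then colprod k ((a \<circ> \<sigma>)(l := p)) a else 0) =
      (\<Sum>l = 1..k. \<Sum>a\<in>?T. if q = a (\<sigma> l) then colprod k (a(\<sigma> l := p) \<circ> \<sigma>) a else 0)"
  proof (subst sum.swap, intro sum.cong refl)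
    fix l a
    \<comment> \<open>Row \<open>l\<close> carries the entry of the tuple at
      \<open>\<sigma> l\<close>, and by injectivity no other row does.\<close>
    have "(a \<circ> \<sigma>)(l := p) = a(\<sigma> l := p) \<circ> \<sigma>"
      by (rule ext) (simp add: inj_eq[OF permutes_inj[OF \<sigma>]])
    then show "(if q = (a \<circ> \<sigma>) l then colprod k ((a \<circ> \<sigma>)(l := p)) a else 0) =
        (if q = a (\<sigma> l) then colprod k (a(\<sigma> l := p) \<circ> \<sigma>) a else 0)"
      by simp
  qed
  also have "\<dots> = (\<Sum>m = 1..k. \<Sum>a\<in>?T. if q = a m then colprod k (a(m := p) \<circ> \<sigma>) a else 0)"
    by (rule sum.reindex_bij_betw[OF permutes_imp_bij[OF \<sigma>]])
  also have "\<dots> = (\<Sum>m = 1..k. \<Sum>a\<in>?T. if p = a m then colprod k (a \<circ> \<sigma>) (a(m := q)) else 0)"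
  proof (rule sum.cong[OF refl])
    fix m assume m: "m \<in> {1..k}"
    have "(\<Sum>a\<in>?T \<inter> {a. q = a m}. colprod k (a(m := p) \<circ> \<sigma>) a) =
        (\<Sum>a\<in>?T \<inter> {a. p = a m}. colprod k (a \<circ> \<sigma>) (a(m := q)))"
      by (rule sum.reindex_bij_witness[where i = "\<lambda>a. a(m := q)" and j = "\<lambda>a. a(m := p)"])
        (use m in \<open>auto simp: PiE_def extensional_def\<close>)
    then show "(\<Sum>a\<in>?T. if q = a m then colprod k (a(m := p) \<circ> \<sigma>) a else 0) =
        (\<Sum>a\<in>?T. if p = a m then colprod k (a \<circ> \<sigma>) (a(m := q)) else 0)"
      using fin by (simp only: sum.If_cases sum.neutral_const add_0_right)
  qed
  also have "\<dots> = (\<Sum>a\<in>?T. \<Sum>l = 1..k. if p = a l then colprod k (a \<circ> \<sigma>) (a(l := q)) else 0)"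
    by (rule sum.swap)
  finally have "(\<Sum>a\<in>?T. E p q * colprod k (a \<circ> \<sigma>) a - colprod k (a \<circ> \<sigma>) a * E p q) = 0"
    unfolding colprod_commutator sum_subtractf by simp
  then show ?thesis
    by (simp add: sum_subtractf sum_distrib_left sum_distrib_right)
qed

lemma sum_minor_all_tuples_commutes:
  "E p q * (\<Sum>a\<in>{1..k} \<rightarrow>\<^sub>E UNIV. minor k a a) = (\<Sum>a\<in>{1..k} \<rightarrow>\<^sub>E UNIV. minor k a a) * E p q"
proof -
  let ?S = "\<lambda>\<sigma>. \<Sum>a\<in>{1..k} \<rightarrow>\<^sub>E UNIV. colprod k (a \<circ> \<sigma>) a"
  have Z: "(\<Sum>a\<in>{1..k} \<rightarrow>\<^sub>E UNIV. minor k a a) =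
      (\<Sum>\<sigma> | \<sigma> permutes {1..k}. of_int (sign \<sigma>) * ?S \<sigma>)"
    unfolding minor_def by (subst sum.swap) (simp add: sum_distrib_left)
  have swap: "E p q * (of_int (sign \<sigma>) * ?S \<sigma>) = of_int (sign \<sigma>) * ?S \<sigma> * E p q"
    if "\<sigma> permutes {1..k}" for \<sigma>
  proof -
    have "E p q * (of_int (sign \<sigma>) * ?S \<sigma>) = of_int (sign \<sigma>) * (E p q * ?S \<sigma>)"
      by (simp only: mult.assoc[symmetric] mult_of_int_commute[of _ "E p q"])
    then show ?thesis
      by (simp only: sum_colprod_commutes[OF that] mult.assoc)
  qed
  show ?thesis
    unfolding Z sum_distrib_left[where r = "E p q"] sum_distrib_right[where r = "E p q"]
    by (rule sum.cong[OF refl], rule swap, erule CollectD)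
qed

end

section \<open>The elements \<open>H\<^sub>k(n)\<close>\<close>

lemma elem_mat_mult: "elem_mat i j ** elem_mat p q = (if j = p then elem_mat i q else 0)"
proof -
  have "(\<Sum>m\<in>UNIV. elem_mat i j $ a $ m * elem_mat p q $ m $ b) =
      (\<Sum>m\<in>UNIV. if m = j then (if a = i \<and> j = p \<and> b = q then 1 else 0) else 0)" for a b
    by (rule sum.cong) (auto simp: elem_mat_def)
  then show ?thesis
    by (auto simp: vec_eq_iff matrix_matrix_mult_def) (auto simp: elem_mat_def)
qed

lemma gl_bracket_elem_mat:
  "gl_bracket (elem_mat i j) (elem_mat p q) =
    (if j = p then elem_mat i q else 0) - (if i = q then elem_mat p j else 0)"
  by (auto simp: gl_bracket_def elem_mat_mult)

lemma gl_eq_sum_elem_mat: "A = (\<Sum>i\<in>UNIV. \<Sum>j\<in>UNIV. gl_scale (A $ i $ j) (elem_mat i j))"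
proof -
  have "(\<Sum>i\<in>UNIV. \<Sum>j\<in>UNIV. gl_scale (A $ i $ j) (elem_mat i j) $ a $ b) = A $ a $ b" for a b
  proof -
    have "(\<Sum>j\<in>UNIV. gl_scale (A $ i $ j) (elem_mat i j) $ a $ b) =
        (if i = a then A $ a $ b else 0)" for i
      by (auto simp: gl_scale_def elem_mat_def if_distrib[of "times _"] cong: if_cong)
    then show ?thesis by simp
  qed
  then show ?thesis
    by (simp add: vec_eq_iff)
qed

lemma ugl_of_add: "ugl_of (A + B) = ugl_of A + ugl_of B"
  by transfer (use env_ideal.rel_add in \<open>simp add: env_rel_def\<close>)

lemma ugl_of_0: "ugl_of 0 = 0"
  using ugl_of_add[of 0 0] by simp

lemma ugl_of_diff: "ugl_of (A - B) = ugl_of A - ugl_of B"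
  using ugl_of_add[of "A - B" B] by (simp add: algebra_simps)

lemma ugl_of_bracket: "ugl_of A * ugl_of B - ugl_of B * ugl_of A = ugl_of (gl_bracket A B)"
  by transfer (use env_ideal.rel_bracket in \<open>simp add: env_rel_def\<close>)

interpretation ugl: gl_generators e_gen
proof
  show "e_gen i j * e_gen p q - e_gen p q * e_gen i j =
      (if j = p then e_gen i q else 0) - (if i = q then e_gen p j else 0)" for i j p q
    by (simp add: e_gen_def ugl_of_bracket gl_bracket_elem_mat ugl_of_diff ugl_of_0)
qed

text \<open>One side compares positions and shifts by the row, the other compares index values and
  shifts by the column. For injective \<open>i\<close> the two conditions agree, and where they hold
  row and column coincide.\<close>

lemma H_elem_eq_sum_minor:
  "H_elem k = (\<Sum>i\<in>increasing_seqs k. ugl.minor k i (i :: nat \<Rightarrow> 'n::{finite,linorder}))"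
  unfolding H_elem_def cdet_def ugl.minor_def ugl.colprod_def ugl.shifted_def
proof (intro sum.cong refl arg_cong2[where f = times] arg_cong[where f = prod_list] map_cong)
  fix i :: "nat \<Rightarrow> 'n" and \<sigma> j
  assume *: "i \<in> increasing_seqs k" "\<sigma> \<in> {\<sigma>. \<sigma> permutes {1..k}}" "j \<in> set [1..<Suc k]"
  have "inj_on i {1..k}"
    using * by (auto simp: increasing_seqs_def intro: strict_mono_on_imp_inj_on)
  moreover have "j \<in> {1..k}" "\<sigma> j \<in> {1..k}"
    using * permutes_in_image[of \<sigma> "{1..k}" j] by auto
  ultimately have "i (\<sigma> j) = i j \<longleftrightarrow> \<sigma> j = j"
    by (metis inj_on_eq_iff)
  then show "e_gen (i (\<sigma> j)) (i j) + (if \<sigma> j = j then of_nat (k - \<sigma> j) else 0) =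
      e_gen ((i \<circ> \<sigma>) j) (i j) + (if (i \<circ> \<sigma>) j = i j then of_nat (k - j) else 0)"
    by simp
qed

text \<open>Take the largest moved point: its image is moved too, hence cannot lie above it. In the
  column product this gives a raising operator followed only by diagonal entries.\<close>

lemma permutes_moves_down:
  fixes \<sigma> :: "nat \<Rightarrow> nat"
  assumes "\<sigma> permutes {1..k}" "\<sigma> \<noteq> id"
  obtains j where "j \<in> {1..k}" "\<sigma> j < j" "\<And>l. j < l \<Longrightarrow> \<sigma> l = l"
proof -
  let ?M = "{j \<in> {1..k}. \<sigma> j \<noteq> j}"
  have "?M \<noteq> {}"
    using assms permutes_not_in[OF assms(1)] by (fastforce simp: fun_eq_iff)
  then have j: "Max ?M \<in> ?M"
    by (intro Max_in) auto
  have fixed: "\<sigma> l = l" if "Max ?M < l" for l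
  proof (rule ccontr)
    assume "\<sigma> l \<noteq> l"
    then have "l \<in> ?M"
      using permutes_not_in[OF assms(1), of l] by blast
    then have "l \<le> Max ?M" by (intro Max_ge) auto
    then show False using that by simp
  qed
  have "\<sigma> (Max ?M) < Max ?M"
  proof (rule ccontr)
    assume "\<not> \<sigma> (Max ?M) < Max ?M"
    then have "Max ?M < \<sigma> (Max ?M)" using j by auto
    then have "\<sigma> (\<sigma> (Max ?M)) = \<sigma> (Max ?M)" by (rule fixed)
    then show False
      using j by (simp add: inj_eq[OF permutes_inj[OF assms(1)]])
  qed
  then show ?thesis
    using that j fixed by blast
qed

section \<open>The action on modules and on highest weight vectors\<close>

context gl_module
begin

lemma ugl_act_sum: "ugl_act sc \<rho> (sum f S) v = (\<Sum>x\<in>S. ugl_act sc \<rho> (f x) v)"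
  by (induction S rule: infinite_finite_induct) (simp_all add: ugl_act_0 ugl_act_add)

lemma ugl_act_uminus: "ugl_act sc \<rho> (- x) v = - ugl_act sc \<rho> x v"
  using ugl_act_add[of x "- x" v] by (simp add: ugl_act_0 eq_neg_iff_add_eq_0 add.commute)

lemma ugl_act_of_nat: "ugl_act sc \<rho> (of_nat m) v = sc (of_nat m) v"
  by (induction m) (simp_all add: ugl_act_0 ugl_act_1 ugl_act_add scale_left_distrib)

lemma ugl_act_of_int: "ugl_act sc \<rho> (of_int m) v = sc (of_int m) v"
  by (cases m rule: int_cases2) (simp_all add: ugl_act_uminus ugl_act_of_nat)

lemma ugl_act_add_right: "ugl_act sc \<rho> x (v + w) = ugl_act sc \<rho> x v + ugl_act sc \<rho> x w"
  by (simp add: ugl_act_def free_act_add_right)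

lemma ugl_act_scale_right: "ugl_act sc \<rho> x (sc c v) = sc c (ugl_act sc \<rho> x v)"
  by (simp add: ugl_act_def free_act_scale_right)

lemma ugl_act_zero_right: "ugl_act sc \<rho> x 0 = 0"
  using ugl_act_scale_right[of x 0 0] by simp

lemma act_e_gen: "ugl_act sc \<rho> (e_gen p q) v = \<rho> (elem_mat p q) v"
  by (simp add: e_gen_def ugl_act_ugl_of)

lemma act_zero_left: "\<rho> 0 v = 0"
  using act_add[of 0 0 v] by simp

lemma act_sum: "\<rho> (sum f S) v = (\<Sum>x\<in>S. \<rho> (f x) v)"
  by (induction S rule: infinite_finite_induct) (simp_all add: act_zero_left act_add)

lemma ugl_act_prod_list:
  assumes "\<And>x. x \<in> set xs \<Longrightarrow> ugl_act sc \<rho> (f x) v = sc (c x) v"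
  shows "ugl_act sc \<rho> (prod_list (map f xs)) v = sc (prod_list (map c xs)) v"
  using assms
  by (induction xs) (simp_all add: ugl_act_1 ugl_act_mult ugl_act_scale_right mult.commute)

end

text \<open>Increasing sequences and highest weights require an order on the index type, for which
  \<open>gl_module\<close> asks only finiteness.\<close>

locale linordered_gl_module = gl_module sc \<rho>
  for sc :: "complex \<Rightarrow> 'v::ab_group_add \<Rightarrow> 'v"
    and \<rho> :: "'n::{finite,linorder} gl \<Rightarrow> 'v \<Rightarrow> 'v"
begin

text \<open>The sum over all tuples shows that \<open>fact k\<close> times \<open>H_elem k\<close>
  commutes with the generators; the nonzero factor is cancelled in the complex vector space.\<close>

lemma H_elem_commutes_elem_mat:
  "ugl_act sc \<rho> (H_elem k) (\<rho> (elem_mat p q) v) = \<rho> (elem_mat p q) (ugl_act sc \<rho> (H_elem k) v)"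
proof -
  have "e_gen p q * (of_nat (fact k) * H_elem k) = of_nat (fact k) * H_elem k * e_gen p q"
    using ugl.sum_minor_all_tuples_commutes[of p q k]
    by (simp only: H_elem_eq_sum_minor ugl.sum_minor_all_tuples)
  then have "ugl_act sc \<rho> (e_gen p q * (of_nat (fact k) * H_elem k)) v =
      ugl_act sc \<rho> (of_nat (fact k) * H_elem k * e_gen p q) v"
    by simp
  then show ?thesis
    by (simp add: ugl_act_mult ugl_act_of_nat act_e_gen act_scale_right)
qed

text \<open>Factors act from the right. If \<open>\<sigma>\<close> is not the identity, the columns
  beyond the last moved one rescale \<open>v\<close>, and the factor at that column has row index
  below column index and kills it.\<close>

lemma minor_highest_weight:
  assumes hw: "highest_weight_vector sc \<rho> wt v" and i: "i \<in> increasing_seqs k"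
  shows "ugl_act sc \<rho> (ugl.minor k i i) v = sc (\<Prod>a = 1..k. wt (i a) + of_nat (k - a)) v"
proof -
  have mono: "strict_mono_on {1..k} i"
    using i by (simp add: increasing_seqs_def)
  have diag: "ugl_act sc \<rho> (ugl.shifted u x x) v = sc (wt x + of_nat u) v" for u x
    using hw by (simp add: ugl.shifted_def highest_weight_vector_def ugl_act_add act_e_gen
        ugl_act_of_nat scale_left_distrib)
  have raise: "ugl_act sc \<rho> (ugl.shifted u x y) v = 0" if "x < y" for u x y
    using hw that less_imp_neq[OF that]
    by (simp add: ugl.shifted_def highest_weight_vector_def act_e_gen)
  have off: "ugl_act sc \<rho> (ugl.colprod k (i \<circ> \<sigma>) i) v = 0"
    if \<sigma>: "\<sigma> permutes {1..k}" and ne: "\<sigma> \<noteq> id" for \<sigma>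
  proof -
    obtain j where j: "j \<in> {1..k}" "\<sigma> j < j" and fixed: "\<And>l. j < l \<Longrightarrow> \<sigma> l = l"
      using permutes_moves_down[OF \<sigma> ne] by blast
    let ?f = "\<lambda>j. ugl.shifted (k - j) ((i \<circ> \<sigma>) j) (i j)"
    let ?vs = "[Suc j..<Suc k]"
    have "[1..<Suc k] = [1..<j] @ [j..<Suc k]"
      using j upt_add_eq_append[of 1 j "Suc k - j"] by simp
    then have upt: "[1..<Suc k] = [1..<j] @ j # ?vs"
      using j by (simp add: upt_conv_Cons)
    have "\<sigma> j \<in> {1..k}"
      using permutes_in_image[OF \<sigma>] j by blast
    then have "ugl_act sc \<rho> (?f j) v = 0"
      using strict_mono_onD[OF mono _ j(1) j(2)] by (simp add: raise)
    moreover have "ugl_act sc \<rho> (prod_list (map ?f ?vs)) v =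
        sc (prod_list (map (\<lambda>l. wt (i l) + of_nat (k - l)) ?vs)) v"
      by (rule ugl_act_prod_list) (use fixed diag in \<open>auto simp: Suc_le_eq\<close>)
    ultimately show ?thesis
      unfolding ugl.colprod_def upt map_append list.map prod_list.append prod_list.Cons
      by (simp add: ugl_act_mult ugl_act_scale_right ugl_act_zero_right)
  qed
  have "ugl_act sc \<rho> (ugl.minor k i i) v =
      (\<Sum>\<sigma> | \<sigma> permutes {1..k}. sc (of_int (sign \<sigma>)) (ugl_act sc \<rho> (ugl.colprod k (i \<circ> \<sigma>) i) v))"
    by (simp add: ugl.minor_def ugl_act_sum ugl_act_mult ugl_act_of_int)
  also have "\<dots> = (\<Sum>\<sigma>\<in>{id}. sc (of_int (sign \<sigma>)) (ugl_act sc \<rho> (ugl.colprod k (i \<circ> \<sigma>) i) v))"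
    by (rule sum.mono_neutral_right) (auto simp: finite_permutations permutes_id off)
  also have "\<dots> = ugl_act sc \<rho> (ugl.colprod k i i) v"
    by (simp add: sign_id)
  also have "\<dots> = sc (prod_list (map (\<lambda>a. wt (i a) + of_nat (k - a)) [1..<Suc k])) v"
    unfolding ugl.colprod_def by (rule ugl_act_prod_list) (rule diag)
  also have "prod_list (map (\<lambda>a. wt (i a) + of_nat (k - a)) [1..<Suc k]) =
      (\<Prod>a = 1..k. wt (i a) + of_nat (k - a))"
    by (simp add: prod.distinct_set_conv_list[symmetric] atLeastLessThanSuc_atLeastAtMost
        del: upt_Suc)
  finally show ?thesis .
qed

end

theorem proposition4p15:
  fixes sc :: "complex \<Rightarrow> 'v::ab_group_add \<Rightarrow> 'v"
    and \<rho> :: "'n::{finite,linorder} gl \<Rightarrow> 'v \<Rightarrow> 'v"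
    and \<mu> :: "nat list"
    and k :: nat
  assumes "1 \<le> k" and "k \<le> CARD('n)"
    and "is_partition \<mu>" and "partition_part \<mu> 1 \<le> CARD('n)"
    and "is_Schur_module sc \<rho> \<mu>"
  shows "\<forall>v. ugl_act sc \<rho> (H_elem k) v =
    sc (\<Sum>i\<in>(increasing_seqs k :: (nat \<Rightarrow> 'n) set).
             \<Sum>\<sigma> | \<sigma> permutes (i ` {1..k}). Gam \<sigma> \<mu> k i) v"
proof -
  let ?c = "\<Sum>i\<in>(increasing_seqs k :: (nat \<Rightarrow> 'n) set).
    \<Sum>\<sigma> | \<sigma> permutes (i ` {1..k}). Gam \<sigma> \<mu> k i"
  \<comment> \<open>The eigenspace for the claimed eigenvalue: a submodule that contains the highest
    weight vector.\<close>
  let ?W = "{w. ugl_act sc \<rho> (H_elem k) w = sc ?c w}"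
  have irr: "irreducible_gl_module sc \<rho>"
    using assms by (simp add: is_Schur_module_def)
  then interpret linordered_gl_module sc \<rho>
    by (simp add: irreducible_gl_module_def linordered_gl_module_def)
  obtain v where v: "highest_weight_vector sc \<rho> (schur_weight \<mu>) v"
    using assms by (auto simp: is_Schur_module_def)
  have "ugl_act sc \<rho> (H_elem k) v =
      (\<Sum>i\<in>(increasing_seqs k :: (nat \<Rightarrow> 'n) set).
        sc (\<Sum>\<sigma> | \<sigma> permutes (i ` {1..k}). Gam \<sigma> \<mu> k i) v)"
    unfolding H_elem_eq_sum_minor ugl_act_sum
    by (rule sum.cong[OF refl], subst sum_Gam)
      (auto simp: minor_highest_weight[OF v] increasing_seqs_def)
  then have vW: "v \<in> ?W"
    by (simp add: scale_sum_left)
  have v0: "v \<noteq> 0"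
    using v by (simp add: highest_weight_vector_def)
  have sub: "subspace ?W"
    by (rule subspaceI)
      (simp_all add: ugl_act_zero_right ugl_act_add_right ugl_act_scale_right
        scale_right_distrib mult.commute)
  have invariant: "\<rho> A w \<in> ?W" if w: "w \<in> ?W" for A w
  proof -
    have "\<rho> (elem_mat i j) w \<in> ?W" for i j
      using w by (simp add: H_elem_commutes_elem_mat act_scale_right)
    \<comment> \<open>Invariance under the matrix units extends to \<open>A\<close> by expanding
      \<open>A\<close> in them.\<close>
    then have "(\<Sum>i\<in>UNIV. \<Sum>j\<in>UNIV. sc (A $ i $ j) (\<rho> (elem_mat i j) w)) \<in> ?W"
      by (intro subspace_sum[OF sub] subspace_scale[OF sub])
    then show ?thesis
      by (subst gl_eq_sum_elem_mat) (simp only: act_sum act_scale)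
  qed
  have "?W = {0} \<or> ?W = UNIV"
    using irr[unfolded irreducible_gl_module_def, THEN conjunct2, THEN conjunct2, rule_format, of ?W]
      sub invariant by simp
  then have "?W = UNIV"
    using vW v0 by blast
  then show ?thesis by blast
qed

end
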